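(* Let $N,K$ be integers with $0\le K<N-2$, $\epsilon=1/N$, $F>0$, and let $\mathcal{E}^{qnl}$ be the quasi-nonlocal (EAM-QNL) energy with pair potential $\phi$, electron density $\rho$ and embedding function $G$ (see context). Suppose that $$\phi''_{F}>0,\quad \phi''_{2F}<0,\quad \rho'_{F}\le 0,\quad \rho'_{2F}\le 0,\quad \rho''_{F}\ge 0,\quad \rho''_{2F}\ge 0,\quad G''_{F}\ge 0,$$ and that $$\phi''_{2F}+G''_{F}\left[(\rho'_{F})^2+20(\rho'_{2F})^2+12\rho'_{F}\rho'_{2F}\right]+2G'_{F}\rho''_{2F}\le 0 .$$ Then the uniform deformation $\mathbf{y}_F$ is stable in the QNL model (that is, $\langle\delta^2\mathcal{E}^{qnl}(\mathbf{y}_F)\mathbf{u},\mathbf{u}\rangle>0$ for all $\mathbf{u}\in\mathcal{U}\setminus\{\mathbf{0}\}$) if and only if $\hat A_F+\tilde A_F>0$.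
   Context: Setting. Let $N\ge1$ be an integer, $\epsilon=1/N$, $F>0$. $\mathcal{U}$ is the space of real sequences $\mathbf{u}=(u_\ell)_{\ell\in\mathbb{Z}}$ with $u_{\ell+2N}=u_\ell$ and $\sum_{\ell=-N+1}^N u_\ell=0$. Put $(\mathbf{y}_F)_\ell=F\epsilon\ell$ and $\mathcal{Y}_F=\{\mathbf{y}_F+\mathbf{u}:\mathbf{u}\in\mathcal{U}\}$. For a sequence $\mathbf{v}$ write $v'_\ell=Dv_\ell=(v_\ell-v_{\ell-1})/\epsilon$. Let $\phi,\rho,G$ be smooth real-valued functions ($\phi,\rho$ on $(0,\infty)$, $G$ on $\mathbb{R}$); energies are considered for $\mathbf{y}\in\mathcal{Y}_F$ with all $y'_\ell>0$. Densities: $$\bar\rho^a_\ell(\mathbf{y})=\rho(y'_\ell)+\rho(y'_\ell+y'_{\ell-1})+\rho(y'_{\ell+1})+\rho(y'_{\ell+1}+y'_{\ell+2}),$$ $$\bar\rho^c_\ell(\mathbf{y})=2\rho(y'_\ell)+2\rho(2y'_\ell),\qquad \bar\rho^{qnl}_\ell(\mathbf{y})=2\rho(y'_\ell)+2\rho(y'_\ell+y'_{\ell-1}).$$ Per-atom energies: $$\mathcal{E}^a_\ell(\mathbf{y})=G(\bar\rho^a_\ell(\mathbf{y}))+\tfrac12[\phi(y'_\ell)+\phi(y'_\ell+y'_{\ell-1})+\phi(y'_{\ell+1})+\phi(y'_{\ell+1}+y'_{\ell+2})],$$ $$\mathcal{E}^c_\ell(\mathbf{y})=\tfrac12G(\bar\rho^c_\ell(\mathbf{y}))+\tfrac12G(\bar\rho^c_{\ell+1}(\mathbf{y}))+\tfrac12[\phi(y'_\ell)+\phi(2y'_\ell)+\phi(y'_{\ell+1})+\phi(2y'_{\ell+1})].$$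 QNL energy, for an integer $K$ with $0\le K\le N-3$: $\mathcal{E}^{qnl}(\mathbf{y})=\epsilon\sum_{\ell=-N+1}^N\mathcal{E}^{qnl}_\ell(\mathbf{y})$, where $\mathcal{E}^{qnl}_\ell=\mathcal{E}^a_\ell$ for $0\le\ell\le K$; for $\ell\in\{K+1,K+2\}$, $$\mathcal{E}^{qnl}_\ell(\mathbf{y})=\tfrac12G(\bar\rho^{qnl}_\ell(\mathbf{y}))+\tfrac12G(\bar\rho^c_{\ell+1}(\mathbf{y}))+\tfrac12[\phi(y'_\ell)+\phi(y'_{\ell+1})+\phi(y'_\ell+y'_{\ell-1})+\phi(2y'_{\ell+1})];$$ $\mathcal{E}^{qnl}_\ell=\mathcal{E}^c_\ell$ for $K+3\le\ell\le N$; and for $-N+1\le\ell\le-1$ it is defined symmetrically by reflection: $\mathcal{E}^{qnl}_{\ell}(\mathbf{y})$ is obtained from the formula for $\mathcal{E}^{qnl}_{-\ell}(\mathbf{y})$ by replacing every $y'_j$ by $y'_{1-j}$ (so that atom $\ell$ and atom $-\ell$ are mirror images). For an energy $\mathcal{E}$, the second variation is $\langle\delta^2\mathcal{E}(\mathbf{y})\mathbf{v},\mathbf{w}\rangle=\sum_{\ell,m=-N+1}^N\frac{\partial^2\mathcal{E}}{\partial y_\ell\partial y_m}(\mathbf{y})v_\ell w_m=\frac{\partial^2}{\partial s\,\partial t}\mathcal{E}(\mathbf{y}+s\mathbf{v}+t\mathbf{w})\big|_{s=t=0}$ for $\mathbf{v},\mathbf{w}\in\mathcal{U}$. Notation: $\phi''_F=\phi''(F)$,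 $\phi''_{2F}=\phi''(2F)$, $\rho'_F=\rho'(F)$, $\rho'_{2F}=\rho'(2F)$, $\rho''_F=\rho''(F)$, $\rho''_{2F}=\rho''(2F)$, $G'_F=G'(\bar\rho_F)$, $G''_F=G''(\bar\rho_F)$, where $\bar\rho_F=2\rho(F)+2\rho(2F)$ (the common value of $\bar\rho^a_\ell,\bar\rho^c_\ell,\bar\rho^{qnl}_\ell$ at $\mathbf{y}_F$). Further $$\tilde A_F=\phi''_F+4\phi''_{2F},\qquad \hat A_F=4G''_F(\rho'_F+2\rho'_{2F})^2+2G'_F(\rho''_F+4\rho''_{2F}).$$ *)

theory Defs
  imports "HOL-Analysis.Analysis"
begin

text \<open>
  Infinite differentiability of a real function on an \<^emph>\<open>open\<close> set \<open>S\<close>; there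
  \<open>deriv\<close> and \<open>differentiable_on\<close> only see values of \<open>f\<close> inside \<open>S\<close>.
\<close>
definition smooth_on :: "real set \<Rightarrow> (real \<Rightarrow> real) \<Rightarrow> bool" where
  "smooth_on S f \<longleftrightarrow> (\<forall>n. (deriv ^^ n) f differentiable_on S)"

definition eps :: "int \<Rightarrow> real" where
  "eps N = 1 / real_of_int N"

definition U_space :: "int \<Rightarrow> (int \<Rightarrow> real) set" where
  "U_space N = {u. (\<forall>l. u (l + 2 * N) = u l) \<and> (\<Sum>l = -N + 1..N. u l) = 0}"

definition y_unif :: "int \<Rightarrow> real \<Rightarrow> int \<Rightarrow> real" where
  "y_unif N F l = F * eps N * real_of_int l"

definition D :: "int \<Rightarrow> (int \<Rightarrow> real) \<Rightarrow> int \<Rightarrow> real" where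
  "D N v l = (v l - v (l - 1)) / eps N"

text \<open>
  Densities and per-atom energies depend on the deformation \<open>y\<close> only through
  its strains \<open>r = D N y\<close> and are written as functions of \<open>r\<close>, so that the reflection
  of atoms amounts to replacing \<open>r j\<close> by \<open>r (1 - j)\<close>. The functions \<open>\<phi>\<close> and \<open>\<rho>\<close>
  are only meaningful on positive arguments; hence the energies are only
  meaningful where all strains are positive.
\<close>
definition rho_a :: "(real \<Rightarrow> real) \<Rightarrow> (int \<Rightarrow> real) \<Rightarrow> int \<Rightarrow> real" where
  "rho_a \<rho> r l = \<rho> (r l) + \<rho> (r l + r (l - 1)) + \<rho> (r (l + 1)) + \<rho> (r (l + 1) + r (l + 2))"

definition rho_c :: "(real \<Rightarrow> real) \<Rightarrow> (int \<Rightarrow> real) \<Rightarrow> int \<Rightarrow> real" where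
  "rho_c \<rho> r l = 2 * \<rho> (r l) + 2 * \<rho> (2 * r l)"

definition rho_qnl :: "(real \<Rightarrow> real) \<Rightarrow> (int \<Rightarrow> real) \<Rightarrow> int \<Rightarrow> real" where
  "rho_qnl \<rho> r l = 2 * \<rho> (r l) + 2 * \<rho> (r l + r (l - 1))"

definition atom_a ::
  "(real \<Rightarrow> real) \<Rightarrow> (real \<Rightarrow> real) \<Rightarrow> (real \<Rightarrow> real) \<Rightarrow> (int \<Rightarrow> real) \<Rightarrow> int \<Rightarrow> real" where
  "atom_a \<phi> \<rho> G r l =
     G (rho_a \<rho> r l)
     + 1/2 * (\<phi> (r l) + \<phi> (r l + r (l - 1)) + \<phi> (r (l + 1)) + \<phi> (r (l + 1) + r (l + 2)))"

definition atom_c ::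
  "(real \<Rightarrow> real) \<Rightarrow> (real \<Rightarrow> real) \<Rightarrow> (real \<Rightarrow> real) \<Rightarrow> (int \<Rightarrow> real) \<Rightarrow> int \<Rightarrow> real" where
  "atom_c \<phi> \<rho> G r l =
     1/2 * G (rho_c \<rho> r l) + 1/2 * G (rho_c \<rho> r (l + 1))
     + 1/2 * (\<phi> (r l) + \<phi> (2 * r l) + \<phi> (r (l + 1)) + \<phi> (2 * r (l + 1)))"

definition atom_interface ::
  "(real \<Rightarrow> real) \<Rightarrow> (real \<Rightarrow> real) \<Rightarrow> (real \<Rightarrow> real) \<Rightarrow> (int \<Rightarrow> real) \<Rightarrow> int \<Rightarrow> real" where
  "atom_interface \<phi> \<rho> G r l =
     1/2 * G (rho_qnl \<rho> r l) + 1/2 * G (rho_c \<rho> r (l + 1))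
     + 1/2 * (\<phi> (r l) + \<phi> (r (l + 1)) + \<phi> (r l + r (l - 1)) + \<phi> (2 * r (l + 1)))"

definition atom_qnl_right ::
  "int \<Rightarrow> (real \<Rightarrow> real) \<Rightarrow> (real \<Rightarrow> real) \<Rightarrow> (real \<Rightarrow> real) \<Rightarrow> (int \<Rightarrow> real) \<Rightarrow> int \<Rightarrow> real" where
  "atom_qnl_right K \<phi> \<rho> G r l =
     (if l \<le> K then atom_a \<phi> \<rho> G r l
      else if l \<le> K + 2 then atom_interface \<phi> \<rho> G r l
      else atom_c \<phi> \<rho> G r l)"

definition atom_qnl ::
  "int \<Rightarrow> (real \<Rightarrow> real) \<Rightarrow> (real \<Rightarrow> real) \<Rightarrow> (real \<Rightarrow> real) \<Rightarrow> (int \<Rightarrow> real) \<Rightarrow> int \<Rightarrow> real" where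
  "atom_qnl K \<phi> \<rho> G r l =
     (if 0 \<le> l then atom_qnl_right K \<phi> \<rho> G r l
      else atom_qnl_right K \<phi> \<rho> G (\<lambda>j. r (1 - j)) (- l))"

definition E_qnl ::
  "int \<Rightarrow> int \<Rightarrow> (real \<Rightarrow> real) \<Rightarrow> (real \<Rightarrow> real) \<Rightarrow> (real \<Rightarrow> real) \<Rightarrow> (int \<Rightarrow> real) \<Rightarrow> real" where
  "E_qnl N K \<phi> \<rho> G y = eps N * (\<Sum>l = -N + 1..N. atom_qnl K \<phi> \<rho> G (D N y) l)"

definition second_variation ::
  "((int \<Rightarrow> real) \<Rightarrow> real) \<Rightarrow> (int \<Rightarrow> real) \<Rightarrow> (int \<Rightarrow> real) \<Rightarrow> (int \<Rightarrow> real) \<Rightarrow> real" where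
  "second_variation E y v w =
     deriv (\<lambda>s. deriv (\<lambda>t. E (\<lambda>l. y l + s * v l + t * w l)) 0) 0"

definition stable_deformation :: "int \<Rightarrow> ((int \<Rightarrow> real) \<Rightarrow> real) \<Rightarrow> (int \<Rightarrow> real) \<Rightarrow> bool" where
  "stable_deformation N E y \<longleftrightarrow> (\<forall>u \<in> U_space N - {\<lambda>_. 0}. second_variation E y u u > 0)"

abbreviation deriv2 :: "(real \<Rightarrow> real) \<Rightarrow> real \<Rightarrow> real" where
  "deriv2 f \<equiv> deriv (deriv f)"

definition rho_bar :: "(real \<Rightarrow> real) \<Rightarrow> real \<Rightarrow> real" where
  "rho_bar \<rho> F = 2 * \<rho> F + 2 * \<rho> (2 * F)"

definition A_tilde :: "(real \<Rightarrow> real) \<Rightarrow> real \<Rightarrow> real" where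
  "A_tilde \<phi> F = deriv2 \<phi> F + 4 * deriv2 \<phi> (2 * F)"

definition A_hat :: "(real \<Rightarrow> real) \<Rightarrow> (real \<Rightarrow> real) \<Rightarrow> real \<Rightarrow> real" where
  "A_hat \<rho> G F =
     4 * deriv2 G (rho_bar \<rho> F) * (deriv \<rho> F + 2 * deriv \<rho> (2 * F))\<^sup>2
     + 2 * deriv G (rho_bar \<rho> F) * (deriv2 \<rho> F + 4 * deriv2 \<rho> (2 * F))"

end

theory Submission
  imports Defs
begin

text \<open>
  With \<open>r\<close> the strain of \<open>u\<close> and \<open>A\<close> the sum of the two moduli, every atom contributes
  \<open>A / 2 * ((r l)\<^sup>2 + (r (l + 1))\<^sup>2)\<close> to the second variation, plus an excess that vanishes in the
  continuum region. The sum of the excess is a quadratic form in the strain differences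
  near the atomistic region; the second-neighbour hypothesis makes it nonnegative. A displacement
  strained only in the continuum region has no excess, so \<open>A > 0\<close> is also necessary.
\<close>

subsection \<open>Second-order Taylor data\<close>

text \<open>Carrying both derivative values as parameters lets one inference prove differentiability
  and compute the result. The first derivative is required near \<open>x\<close> and the second only
  at \<open>x\<close>, so values of \<open>\<phi>\<close> and \<open>\<rho>\<close> away from the
  uniform state never enter.\<close>

definition has_jet2 :: "(real \<Rightarrow> real) \<Rightarrow> real \<Rightarrow> real \<Rightarrow> real \<Rightarrow> bool" where
  "has_jet2 f x a b \<longleftrightarrow>
     (\<exists>f'. (\<forall>\<^sub>F z in nhds x. (f has_real_derivative f' z) (at z)) \<and> f' x = a
           \<and> (f' has_real_derivative b) (at x))"

lemma has_jet2_imp_deriv2: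
  assumes "has_jet2 f x a b"
  shows "deriv2 f x = b"
proof -
  obtain f' where f': "\<forall>\<^sub>F z in nhds x. (f has_real_derivative f' z) (at z)"
    and b: "(f' has_real_derivative b) (at x)"
    using assms unfolding has_jet2_def by blast
  from f' have "\<forall>\<^sub>F z in nhds x. deriv f z = f' z"
    by eventually_elim (rule DERIV_imp_deriv)
  then have "deriv (deriv f) x = deriv f' x"
    by (rule deriv_cong_ev) simp
  then show ?thesis
    using b by (simp add: DERIV_imp_deriv)
qed

lemma has_jet2_const: "has_jet2 (\<lambda>x. c) x 0 0"
  unfolding has_jet2_def by (intro exI[of _ "\<lambda>x. 0"]) auto

lemma has_jet2_affine: "has_jet2 (\<lambda>x. c + x * a) x a 0"
  unfolding has_jet2_def
  by (intro exI[of _ "\<lambda>x. a"]) (auto intro!: derivative_eq_intros always_eventually)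

lemma has_jet2_add:
  assumes "has_jet2 f x a b" "has_jet2 g x c d"
  shows "has_jet2 (\<lambda>x. f x + g x) x (a + c) (b + d)"
proof -
  obtain f' g' where
    f': "\<forall>\<^sub>F z in nhds x. (f has_real_derivative f' z) (at z)" "f' x = a"
        "(f' has_real_derivative b) (at x)" and
    g': "\<forall>\<^sub>F z in nhds x. (g has_real_derivative g' z) (at z)" "g' x = c"
        "(g' has_real_derivative d) (at x)"
    using assms unfolding has_jet2_def by blast
  from f'(1) g'(1)
  have "\<forall>\<^sub>F z in nhds x. ((\<lambda>x. f x + g x) has_real_derivative f' z + g' z) (at z)"
    by eventually_elim (rule DERIV_add)
  moreover have "((\<lambda>x. f' x + g' x) has_real_derivative b + d) (at x)"
    using f'(3) g'(3) by (rule DERIV_add)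
  ultimately show ?thesis
    unfolding has_jet2_def using f'(2) g'(2) by (intro exI[of _ "\<lambda>z. f' z + g' z"]) auto
qed

lemma has_jet2_compose:
  assumes "has_jet2 h (f x) c d" "has_jet2 f x a b"
  shows "has_jet2 (\<lambda>x. h (f x)) x (c * a) (d * a\<^sup>2 + c * b)"
proof -
  obtain f' h' where
    f': "\<forall>\<^sub>F z in nhds x. (f has_real_derivative f' z) (at z)" "f' x = a"
        "(f' has_real_derivative b) (at x)" and
    h': "\<forall>\<^sub>F z in nhds (f x). (h has_real_derivative h' z) (at z)" "h' (f x) = c"
        "(h' has_real_derivative d) (at (f x))"
    using assms unfolding has_jet2_def by blast
  have fx: "(f has_real_derivative a) (at x)"
    using eventually_nhds_x_imp_x[OF f'(1)] f'(2) by simp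
  \<comment> \<open>Continuity pulls the neighbourhood of \<open>f x\<close> on which
    \<open>h\<close> is differentiable back to a neighbourhood of \<open>x\<close>.\<close>
  then have "filterlim f (nhds (f x)) (nhds x)"
    using DERIV_isCont isCont_def tendsto_at_iff_tendsto_nhds by blast
  with h'(1) have "\<forall>\<^sub>F z in nhds x. (h has_real_derivative h' (f z)) (at (f z))"
    unfolding filterlim_iff by blast
  with f'(1)
  have "\<forall>\<^sub>F z in nhds x. ((\<lambda>x. h (f x)) has_real_derivative h' (f z) * f' z) (at z)"
    by eventually_elim (rule DERIV_chain2)
  moreover have "((\<lambda>z. h' (f z) * f' z) has_real_derivative d * a\<^sup>2 + c * b) (at x)"
    using f'(2) h'(2) DERIV_mult[OF DERIV_chain2[where f = h', OF h'(3) fx] f'(3)]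
    by (simp add: power2_eq_square algebra_simps)
  ultimately show ?thesis
    unfolding has_jet2_def using f'(2) h'(2) by (intro exI[of _ "\<lambda>z. h' (f z) * f' z"]) auto
qed

lemma has_jet2_cmult:
  assumes "has_jet2 f x a b"
  shows "has_jet2 (\<lambda>x. c * f x) x (c * a) (c * b)"
  using has_jet2_compose[of "\<lambda>x. c * x" f x c 0 a b] has_jet2_affine[of 0 c "f x"] assms
  by (simp add: mult.commute)

lemma has_jet2_sum:
  assumes "\<And>i. i \<in> S \<Longrightarrow> has_jet2 (f i) x (a i) (b i)"
  shows "has_jet2 (\<lambda>x. \<Sum>i\<in>S. f i x) x (\<Sum>i\<in>S. a i) (\<Sum>i\<in>S. b i)"
  using assms
proof (induction S rule: infinite_finite_induct)
  case (insert i S)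
  then show ?case
    by (simp add: has_jet2_add)
qed (simp_all add: has_jet2_const)

text \<open>The second derivative of an affine path is zero. The pointwise equation for
  \<open>h\<close> admits arguments such as \<open>F + x * a + (F + x * b)\<close> that become
  affine only after simplification.\<close>

lemma has_jet2_line:
  assumes "has_jet2 f c a b" and "\<And>x. h x = c + x * m"
  shows "has_jet2 (\<lambda>x. f (h x)) 0 (a * m) (b * m\<^sup>2)"
  using has_jet2_compose[of f "\<lambda>x. c + x * m" 0 a b m 0] has_jet2_affine assms by simp

lemma has_jet2_eq:
  assumes "has_jet2 f x a b" "a = a'" "b = b'"
  shows "has_jet2 f x a' b'"
  using assms by simp

lemma smooth_on_imp_has_jet2:
  assumes "smooth_on S f" "open S" "x \<in> S"
  shows "has_jet2 f x (deriv f x) (deriv2 f x)"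
proof -
  have 0: "f differentiable_on S" and 1: "deriv f differentiable_on S"
    using assms(1) unfolding smooth_on_def by (auto dest: spec[of _ 0] spec[of _ 1])
  have *: "(h has_real_derivative deriv h z) (at z)"
    if "h differentiable_on S" "z \<in> S" for h :: "real \<Rightarrow> real" and z
    using that assms(2) differentiable_on_eq_differentiable_at DERIV_deriv_iff_real_differentiable
    by blast
  have "\<forall>\<^sub>F z in nhds x. z \<in> S"
    using assms(2,3) by (rule eventually_nhds_in_open)
  then have "\<forall>\<^sub>F z in nhds x. (f has_real_derivative deriv f z) (at z)"
    by eventually_elim (rule *[OF 0])
  with *[OF 1 assms(3)] show ?thesis
    unfolding has_jet2_def by blast
qed

text \<open>With both directions equal to \<open>u\<close>, the energy depends on \<open>s\<close>
  and \<open>t\<close> only through \<open>s + t\<close>.\<close>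

lemma second_variation_diagonal:
  "second_variation E y u u = deriv2 (\<lambda>x. E (\<lambda>l. y l + x * u l)) 0"
proof -
  define g where "g x = E (\<lambda>l. y l + x * u l)" for x
  have *: "E (\<lambda>l. y l + s * u l + t * u l) = g (s + t)" for s t
    by (simp add: g_def algebra_simps)
  \<comment> \<open>\<open>deriv\<close> is a choice among derivative values, and the shift
    preserves these, so the equation also covers points where \<open>g\<close> is not
    differentiable.\<close>
  have "deriv (\<lambda>t. g (s + t)) 0 = deriv g s" for s
    unfolding deriv_def using DERIV_shift[of g _ 0 s] by (simp add: add.commute)
  then show ?thesis
    unfolding second_variation_def by (simp add: * flip: g_def)
qed

subsection \<open>The excess over the continuum quadratic form\<close>

lemma sum_int_telescope:
  fixes f :: "int \<Rightarrow> real"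
  assumes "a \<le> b"
  shows "(\<Sum>l = a..b. f (l + 1) - f l) = f (b + 1) - f a"
  using assms
proof (induction b rule: int_ge_induct)
  case (step b)
  then have "{a..b + 1} = insert (b + 1) {a..b}" by auto
  with step show ?case by simp
qed simp

text \<open>In use, \<open>g\<close> is G'' at the reference density, \<open>P\<close> is \<rho>'(F)
  + 2 \<rho>'(2F), \<open>q\<close> is \<rho>'(2F) and \<open>c\<close> is the second-neighbour
  curvature. The form separates differences of squares, which telescope, from a quadratic form in
  the strain jumps \<open>d\<close>.\<close>

definition excess_a :: "real \<Rightarrow> real \<Rightarrow> real \<Rightarrow> real \<Rightarrow> (int \<Rightarrow> real) \<Rightarrow> int \<Rightarrow> real" where
  "excess_a g P q c r l =
     (let d = (\<lambda>j. r (j + 1) - r j); W = (\<lambda>j. (r (j + 1))\<^sup>2 - (r j)\<^sup>2) in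
      2 * (g * P * q + c) * (W (l + 1) - W (l - 1))
      + g * (q\<^sup>2 * (d (l + 1) - d (l - 1))\<^sup>2 - P\<^sup>2 * (d l)\<^sup>2
             - 2 * P * q * ((d (l + 1))\<^sup>2 + (d (l - 1))\<^sup>2 + d l * (d (l + 1) + d (l - 1))))
      - c * ((d (l + 1))\<^sup>2 + (d (l - 1))\<^sup>2))"

text \<open>Only the terms coupling the bonds \<open>l - 1\<close> and \<open>l\<close> contribute;
  those of bond \<open>l + 1\<close> are already of continuum type.\<close>

definition excess_i :: "real \<Rightarrow> real \<Rightarrow> real \<Rightarrow> real \<Rightarrow> (int \<Rightarrow> real) \<Rightarrow> int \<Rightarrow> real" where
  "excess_i g P q c r l =
     (2 * g * (q\<^sup>2 - P * q) - c) * (r l - r (l - 1))\<^sup>2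
     - 2 * (g * P * q + c) * ((r l)\<^sup>2 - (r (l - 1))\<^sup>2)"

definition excess_right ::
  "int \<Rightarrow> real \<Rightarrow> real \<Rightarrow> real \<Rightarrow> real \<Rightarrow> (int \<Rightarrow> real) \<Rightarrow> int \<Rightarrow> real" where
  "excess_right K g P q c r l =
     (if l \<le> K then excess_a g P q c r l
      else if l \<le> K + 2 then excess_i g P q c r l else 0)"

definition excess ::
  "int \<Rightarrow> real \<Rightarrow> real \<Rightarrow> real \<Rightarrow> real \<Rightarrow> (int \<Rightarrow> real) \<Rightarrow> int \<Rightarrow> real" where
  "excess K g P q c r l =
     (if 0 \<le> l then excess_right K g P q c r l
      else excess_right K g P q c (\<lambda>j. r (1 - j)) (- l))"

text \<open>Reflection exchanges the jumps at \<open>l - 1\<close> and \<open>l + 1\<close> and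
  flips all signs, which preserves the form. One formula thus serves the atomistic atoms on both
  sides.\<close>

lemma excess_a_reflect: "excess_a g P q c (\<lambda>j. r (1 - j)) (- l) = excess_a g P q c r l"
  by (simp add: excess_a_def Let_def algebra_simps power2_eq_square)

text \<open>The bound on \<open>K\<close> keeps the atoms from \<open>-K - 2\<close> to
  \<open>K + 2\<close> inside the summation range, and all others have zero excess.\<close>

lemma sum_excess:
  assumes "0 \<le> K" "K < N - 2"
  shows "(\<Sum>l = -N + 1..N. excess K g P q c r l) =
    (\<Sum>l = -K..K. excess_a g P q c r l)
    + excess_i g P q c r (K + 1) + excess_i g P q c r (K + 2)
    + excess_i g P q c (\<lambda>j. r (1 - j)) (K + 1) + excess_i g P q c (\<lambda>j. r (1 - j)) (K + 2)"
proof -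
  let ?S = "{-K..K} \<union> {K + 1, K + 2, -K - 1, -K - 2}"
  have "(\<Sum>l = -N + 1..N. excess K g P q c r l) = (\<Sum>l\<in>?S. excess K g P q c r l)"
    using assms by (intro sum.mono_neutral_right) (auto simp: excess_def excess_right_def)
  also have "\<dots> = (\<Sum>l = -K..K. excess K g P q c r l)
      + (\<Sum>l\<in>{K + 1, K + 2, -K - 1, -K - 2}. excess K g P q c r l)"
    by (intro sum.union_disjoint) auto
  also have "(\<Sum>l = -K..K. excess K g P q c r l) = (\<Sum>l = -K..K. excess_a g P q c r l)"
    by (intro sum.cong) (auto simp: excess_def excess_right_def excess_a_reflect)
  finally show ?thesis
    using assms by (simp add: excess_def excess_right_def add.commute)
qed

text \<open>
  The terms that are telescoping differences of \<open>r\<^sup>2\<close> cancel between the atomistic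
  and the interfacial atoms. In what remains, every bond carries the weight \<open>- 2 * c\<close>,
  and AM-GM bounds the mixed products so that only a second difference
  of \<open>d\<^sup>2\<close> is left.
\<close>
lemma sum_excess_nonneg:
  assumes "0 \<le> K" "K < N - 2"
    and g: "0 \<le> g" and Pq: "0 \<le> P * q" and c: "2 * c + g * (P\<^sup>2 + 8 * P * q) \<le> 0"
  shows "0 \<le> (\<Sum>l = -N + 1..N. excess K g P q c r l)"
proof -
  define d where "d j = r (j + 1) - r j" for j
  define W where "W j = (r (j + 1))\<^sup>2 - (r j)\<^sup>2" for j
  define \<kappa> where "\<kappa> = 2 * (g * P * q + c)"
  \<comment> \<open>\<open>- 2 * m\<close> is the weight left on \<open>(d l)\<^sup>2\<close> once
    the mixed products are rewritten by squares of differences.\<close>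
  define m where "m = g * (P\<^sup>2 + 2 * P * q) / 2"
  define \<beta> where "\<beta> = 2 * g * (q\<^sup>2 - P * q) - c"
  have m: "0 \<le> m"
    unfolding m_def using mult_nonneg_nonneg[OF g, of "P\<^sup>2 + 2 * (P * q)"] Pq by (simp add: mult.assoc)
  \<comment> \<open>The hypothesis on \<open>c\<close> gives a gap of at least
    \<open>g * (P * q + 2 * q\<^sup>2)\<close>.\<close>
  have \<beta>: "m \<le> \<beta>"
  proof -
    have "0 \<le> g * (P * q)" "0 \<le> g * q\<^sup>2" using g Pq by simp_all
    with c show ?thesis
      unfolding m_def \<beta>_def by (simp add: algebra_simps add_divide_distrib)
  qed
  have Y: "\<kappa> * (W (l + 1) - W (l - 1)) + m * ((d (l + 1))\<^sup>2 + (d (l - 1))\<^sup>2 - 2 * (d l)\<^sup>2)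
      \<le> excess_a g P q c r l" for l
  proof -
    define x y z where "x = d (l - 1)" and "y = d l" and "z = d (l + 1)"
    have "0 \<le> (- (2 * c + g * (P\<^sup>2 + 8 * P * q))) * (x\<^sup>2 + z\<^sup>2)"
      by (rule mult_nonneg_nonneg) (use c in simp_all)
    moreover have "0 \<le> g * (P * q)"
      using g Pq by (rule mult_nonneg_nonneg)
    then have "0 \<le> g * (P * q) * ((x - y)\<^sup>2 + (z - y)\<^sup>2)"
      by (rule mult_nonneg_nonneg) simp
    moreover have "0 \<le> g * q\<^sup>2 * (z - x)\<^sup>2"
      using g by simp
    \<comment> \<open>Completing squares in \<open>y * x\<close> and \<open>y * z\<close> and
      splitting off \<open>m\<close> leaves exactly the hypothesis factor on
      \<open>x\<^sup>2 + z\<^sup>2\<close>; the 8 arises as 6 from these products and 2 from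
      \<open>m\<close>.\<close>
    moreover have "g * (q\<^sup>2 * (z - x)\<^sup>2 - P\<^sup>2 * y\<^sup>2 - 2 * P * q * (z\<^sup>2 + x\<^sup>2 + y * (z + x))) - c * (z\<^sup>2 + x\<^sup>2)
        = m * (z\<^sup>2 + x\<^sup>2 - 2 * y\<^sup>2) + (- (2 * c + g * (P\<^sup>2 + 8 * P * q))) * (x\<^sup>2 + z\<^sup>2) / 2
          + g * (P * q) * ((x - y)\<^sup>2 + (z - y)\<^sup>2) + g * q\<^sup>2 * (z - x)\<^sup>2"
      unfolding m_def by (simp add: field_simps power2_eq_square)
    ultimately have "m * (z\<^sup>2 + x\<^sup>2 - 2 * y\<^sup>2)
        \<le> g * (q\<^sup>2 * (z - x)\<^sup>2 - P\<^sup>2 * y\<^sup>2 - 2 * P * q * (z\<^sup>2 + x\<^sup>2 + y * (z + x))) - c * (z\<^sup>2 + x\<^sup>2)"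
      by linarith
    then show ?thesis
      unfolding excess_a_def Let_def \<kappa>_def x_def y_def z_def
      by (simp add: d_def W_def)
  qed
  have "(\<Sum>l = -K..K. \<kappa> * (W (l + 1) - W (l - 1)) + m * ((d (l + 1))\<^sup>2 + (d (l - 1))\<^sup>2 - 2 * (d l)\<^sup>2))
      \<le> (\<Sum>l = -K..K. excess_a g P q c r l)"
    by (intro sum_mono Y)
  \<comment> \<open>A difference over two steps telescopes through sums of neighbours, so two
    boundary terms in \<open>W\<close> survive on each side, one per interfacial atom.\<close>
  also have "(\<Sum>l = -K..K. \<kappa> * (W (l + 1) - W (l - 1)) + m * ((d (l + 1))\<^sup>2 + (d (l - 1))\<^sup>2 - 2 * (d l)\<^sup>2))
      = (\<Sum>l = -K..K. (\<lambda>l. \<kappa> * (W l + W (l - 1)) + m * ((d l)\<^sup>2 - (d (l - 1))\<^sup>2)) (l + 1)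
          - (\<lambda>l. \<kappa> * (W l + W (l - 1)) + m * ((d l)\<^sup>2 - (d (l - 1))\<^sup>2)) l)"
    by (intro sum.cong) (auto simp: algebra_simps)
  also have "\<dots> = \<kappa> * (W (K + 1) + W K - W (-K) - W (-K - 1))
      + m * ((d (K + 1))\<^sup>2 - (d K)\<^sup>2 - (d (-K))\<^sup>2 + (d (-K - 1))\<^sup>2)"
    using assms(1) by (subst sum_int_telescope) (auto simp: algebra_simps)
  finally have 1: "\<kappa> * (W (K + 1) + W K - W (-K) - W (-K - 1))
      + m * ((d (K + 1))\<^sup>2 - (d K)\<^sup>2 - (d (-K))\<^sup>2 + (d (-K - 1))\<^sup>2)
      \<le> (\<Sum>l = -K..K. excess_a g P q c r l)" .
  have index: "K + 1 - 1 = K" "K + 2 - 1 = K + 1" "K + 1 + 1 = K + 2" "1 - (K + 1) = -K"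
    "1 - (K + 2) = -K - 1" "1 - K = -K + 1" "-K - 1 + 1 = -K"
    by simp_all
  have 2: "excess_i g P q c r (K + 1) = \<beta> * (d K)\<^sup>2 - \<kappa> * W K"
    "excess_i g P q c r (K + 2) = \<beta> * (d (K + 1))\<^sup>2 - \<kappa> * W (K + 1)"
    "excess_i g P q c (\<lambda>j. r (1 - j)) (K + 1) = \<beta> * (d (-K))\<^sup>2 + \<kappa> * W (-K)"
    "excess_i g P q c (\<lambda>j. r (1 - j)) (K + 2) = \<beta> * (d (-K - 1))\<^sup>2 + \<kappa> * W (-K - 1)"
    unfolding excess_i_def \<beta>_def[symmetric] \<kappa>_def[symmetric] d_def W_def index
    by (simp_all add: power2_eq_square algebra_simps)
  have 3: "m * (d j)\<^sup>2 \<le> \<beta> * (d j)\<^sup>2" "0 \<le> m * (d j)\<^sup>2" for j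
    using \<beta> m by (simp_all add: mult_right_mono)
  \<comment> \<open>The \<open>\<kappa>\<close> terms cancel. The negative boundary terms, at
    \<open>d K\<close> and \<open>d (-K)\<close>, are absorbed because \<open>\<beta>\<close> is at
    least \<open>m\<close>.\<close>
  show ?thesis
    unfolding sum_excess[OF assms(1,2)] 2
    using 1 3(1)[of K] 3(1)[of "K + 1"] 3(1)[of "-K"] 3(1)[of "-K - 1"]
      3(2)[of K] 3(2)[of "K + 1"] 3(2)[of "-K"] 3(2)[of "-K - 1"]
    by (simp add: algebra_simps)
qed

text \<open>The bonds from \<open>-K - 1\<close> to \<open>K + 2\<close> are exactly those on which
  the atomistic and interfacial excesses depend.\<close>

lemma sum_excess_eq_0:
  assumes "0 \<le> K" "K < N - 2" and r: "\<And>j. -K - 1 \<le> j \<Longrightarrow> j \<le> K + 2 \<Longrightarrow> r j = 0"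
  shows "(\<Sum>l = -N + 1..N. excess K g P q c r l) = 0"
proof -
  have "(\<Sum>l = -K..K. excess_a g P q c r l) = 0"
    using r by (intro sum.neutral) (auto simp: excess_a_def Let_def)
  then show ?thesis
    unfolding sum_excess[OF assms(1,2)] using assms(1) r by (simp add: excess_i_def)
qed

subsection \<open>The second variation at the uniform deformation\<close>

text \<open>The left side has the syntactic shape produced by the jet rules, with
  \<open>x, y, z, w\<close> the strains at \<open>l - 1, l, l + 1, l + 2\<close>.\<close>

lemma atom_a_identity:
  fixes x y z w g p q g1 p2 q2 f f2 :: real
  shows "g * (p * y + q * (y + x) + p * z + q * (z + w))\<^sup>2
    + g1 * (p2 * y\<^sup>2 + q2 * (y + x)\<^sup>2 + p2 * z\<^sup>2 + q2 * (z + w)\<^sup>2)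
    + 1/2 * (f * y\<^sup>2 + f2 * (y + x)\<^sup>2 + f * z\<^sup>2 + f2 * (z + w)\<^sup>2) =
    (4 * g * (p + 2 * q)\<^sup>2 + 2 * g1 * (p2 + 4 * q2) + (f + 4 * f2)) / 2 * (y\<^sup>2 + z\<^sup>2)
    + (2 * (g * (p + 2 * q) * q + (f2 / 2 + g1 * q2)) * ((w\<^sup>2 - z\<^sup>2) - (y\<^sup>2 - x\<^sup>2))
      + g * (q\<^sup>2 * ((w - z) - (y - x))\<^sup>2 - (p + 2 * q)\<^sup>2 * (z - y)\<^sup>2
             - 2 * (p + 2 * q) * q
               * ((w - z)\<^sup>2 + (y - x)\<^sup>2 + (z - y) * ((w - z) + (y - x))))
      - (f2 / 2 + g1 * q2) * ((w - z)\<^sup>2 + (y - x)\<^sup>2))"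
  by (simp add: field_simps power2_eq_square)

lemma atom_interface_identity:
  fixes x y z g p q g1 p2 q2 f f2 :: real
  shows "1/2 * (g * (2 * (p * y) + 2 * (q * (y + x)))\<^sup>2
      + g1 * (2 * (p2 * y\<^sup>2) + 2 * (q2 * (y + x)\<^sup>2)))
    + 1/2 * (g * (2 * (p * z) + 2 * (q * (2 * z)))\<^sup>2
      + g1 * (2 * (p2 * z\<^sup>2) + 2 * (q2 * (2 * z)\<^sup>2)))
    + 1/2 * (f * y\<^sup>2 + f * z\<^sup>2 + f2 * (y + x)\<^sup>2 + f2 * (2 * z)\<^sup>2) =
    (4 * g * (p + 2 * q)\<^sup>2 + 2 * g1 * (p2 + 4 * q2) + (f + 4 * f2)) / 2 * (y\<^sup>2 + z\<^sup>2)
    + ((2 * g * (q\<^sup>2 - (p + 2 * q) * q) - (f2 / 2 + g1 * q2)) * (y - x)\<^sup>2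
      - 2 * (g * (p + 2 * q) * q + (f2 / 2 + g1 * q2)) * (y\<^sup>2 - x\<^sup>2))"
  by (simp add: field_simps power2_eq_square)

lemma atom_c_identity:
  fixes y z g p q g1 p2 q2 f f2 :: real
  shows "1/2 * (g * (2 * (p * y) + 2 * (q * (2 * y)))\<^sup>2
      + g1 * (2 * (p2 * y\<^sup>2) + 2 * (q2 * (2 * y)\<^sup>2)))
    + 1/2 * (g * (2 * (p * z) + 2 * (q * (2 * z)))\<^sup>2
      + g1 * (2 * (p2 * z\<^sup>2) + 2 * (q2 * (2 * z)\<^sup>2)))
    + 1/2 * (f * y\<^sup>2 + f2 * (2 * y)\<^sup>2 + f * z\<^sup>2 + f2 * (2 * z)\<^sup>2) =
    (4 * g * (p + 2 * q)\<^sup>2 + 2 * g1 * (p2 + 4 * q2) + (f + 4 * f2)) / 2 * (y\<^sup>2 + z\<^sup>2)"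
  by (simp add: field_simps power2_eq_square)

locale uniform_state =
  fixes \<phi> \<rho> G :: "real \<Rightarrow> real" and F :: real
  assumes jet_\<phi>: "has_jet2 \<phi> F (deriv \<phi> F) (deriv2 \<phi> F)"
      "has_jet2 \<phi> (2 * F) (deriv \<phi> (2 * F)) (deriv2 \<phi> (2 * F))"
    and jet_\<rho>: "has_jet2 \<rho> F (deriv \<rho> F) (deriv2 \<rho> F)"
      "has_jet2 \<rho> (2 * F) (deriv \<rho> (2 * F)) (deriv2 \<rho> (2 * F))"
    and jet_G: "has_jet2 G (rho_bar \<rho> F) (deriv G (rho_bar \<rho> F)) (deriv2 G (rho_bar \<rho> F))"
begin

definition "A = A_hat \<rho> G F + A_tilde \<phi> F"
definition "g = deriv2 G (rho_bar \<rho> F)"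
text \<open>\<open>2 * P\<close> is the derivative of the continuum density with respect to the
  strain of its bond.\<close>

definition "P = deriv \<rho> F + 2 * deriv \<rho> (2 * F)"
definition "q = deriv \<rho> (2 * F)"
definition "c = deriv2 \<phi> (2 * F) / 2 + deriv G (rho_bar \<rho> F) * deriv2 \<rho> (2 * F)"

lemmas coefficient_defs = A_def g_def P_def q_def c_def A_hat_def A_tilde_def

lemma jet_\<phi>_strain:
  "has_jet2 (\<lambda>x. \<phi> (F + x * a)) 0 (deriv \<phi> F * a) (deriv2 \<phi> F * a\<^sup>2)"
  "has_jet2 (\<lambda>x. \<phi> (F + x * a + (F + x * b))) 0
     (deriv \<phi> (2 * F) * (a + b)) (deriv2 \<phi> (2 * F) * (a + b)\<^sup>2)"
  "has_jet2 (\<lambda>x. \<phi> (2 * (F + x * a))) 0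
     (deriv \<phi> (2 * F) * (2 * a)) (deriv2 \<phi> (2 * F) * (2 * a)\<^sup>2)"
  by (rule jet_\<phi>[THEN has_jet2_line]; simp add: algebra_simps)+

lemma jet_\<rho>_strain:
  "has_jet2 (\<lambda>x. \<rho> (F + x * a)) 0 (deriv \<rho> F * a) (deriv2 \<rho> F * a\<^sup>2)"
  "has_jet2 (\<lambda>x. \<rho> (F + x * a + (F + x * b))) 0
     (deriv \<rho> (2 * F) * (a + b)) (deriv2 \<rho> (2 * F) * (a + b)\<^sup>2)"
  "has_jet2 (\<lambda>x. \<rho> (2 * (F + x * a))) 0
     (deriv \<rho> (2 * F) * (2 * a)) (deriv2 \<rho> (2 * F) * (2 * a)\<^sup>2)"
  by (rule jet_\<rho>[THEN has_jet2_line]; simp add: algebra_simps)+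

lemma jet_G_density:
  assumes "has_jet2 h 0 a b" "h 0 = rho_bar \<rho> F"
  shows "has_jet2 (\<lambda>x. G (h x)) 0 (deriv G (rho_bar \<rho> F) * a)
           (deriv2 G (rho_bar \<rho> F) * a\<^sup>2 + deriv G (rho_bar \<rho> F) * b)"
  using has_jet2_compose[of G h 0] assms jet_G by simp

lemma jet_atom_a:
  "\<exists>a. has_jet2 (\<lambda>x. atom_a \<phi> \<rho> G (\<lambda>j. F + x * r j) l) 0 a
     (A / 2 * ((r l)\<^sup>2 + (r (l + 1))\<^sup>2) + excess_a g P q c r l)"
proof -
  have index: "l + 1 + 1 = l + 2" by simp
  show ?thesis
    unfolding atom_a_def rho_a_def
    apply (rule exI)
    \<comment> \<open>Both derivatives become schematic and are synthesised by the jet rules. The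
      first instantiates the existential; the second is left for the polynomial identity.\<close>
    apply (rule has_jet2_eq)
      apply (rule has_jet2_add has_jet2_cmult jet_G_density jet_\<phi>_strain jet_\<rho>_strain refl
        | simp add: rho_bar_def; fail)+
    apply (unfold excess_a_def Let_def coefficient_defs)
    apply (unfold diff_add_cancel index)
    apply (rule atom_a_identity)
    done
qed

lemma jet_atom_interface:
  "\<exists>a. has_jet2 (\<lambda>x. atom_interface \<phi> \<rho> G (\<lambda>j. F + x * r j) l) 0 a
     (A / 2 * ((r l)\<^sup>2 + (r (l + 1))\<^sup>2) + excess_i g P q c r l)"
  unfolding atom_interface_def rho_qnl_def rho_c_def
  apply (rule exI)
  apply (rule has_jet2_eq)
    apply (rule has_jet2_add has_jet2_cmult jet_G_density jet_\<phi>_strain jet_\<rho>_strain refl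
      | simp add: rho_bar_def; fail)+
  apply (unfold excess_i_def coefficient_defs)
  apply (rule atom_interface_identity)
  done

lemma jet_atom_c:
  "\<exists>a. has_jet2 (\<lambda>x. atom_c \<phi> \<rho> G (\<lambda>j. F + x * r j) l) 0 a
     (A / 2 * ((r l)\<^sup>2 + (r (l + 1))\<^sup>2))"
  unfolding atom_c_def rho_c_def
  apply (rule exI)
  apply (rule has_jet2_eq)
    apply (rule has_jet2_add has_jet2_cmult jet_G_density jet_\<phi>_strain jet_\<rho>_strain refl
      | simp add: rho_bar_def; fail)+
  apply (unfold coefficient_defs)
  apply (rule atom_c_identity)
  done

lemma jet_atom_qnl_right:
  "\<exists>a. has_jet2 (\<lambda>x. atom_qnl_right K \<phi> \<rho> G (\<lambda>j. F + x * r j) l) 0 a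
     (A / 2 * ((r l)\<^sup>2 + (r (l + 1))\<^sup>2) + excess_right K g P q c r l)"
  using jet_atom_a[of r l] jet_atom_interface[of r l] jet_atom_c[of r l]
  by (simp add: atom_qnl_right_def excess_right_def)

text \<open>Reflection swaps the two bonds adjacent to an atom, so the continuum part keeps its
  form.\<close>

lemma jet_atom_qnl:
  "\<exists>a. has_jet2 (\<lambda>x. atom_qnl K \<phi> \<rho> G (\<lambda>j. F + x * r j) l) 0 a
     (A / 2 * ((r l)\<^sup>2 + (r (l + 1))\<^sup>2) + excess K g P q c r l)"
  using jet_atom_qnl_right[of K r l] jet_atom_qnl_right[of K "\<lambda>j. r (1 - j)" "- l"]
  by (simp add: atom_qnl_def excess_def add.commute)

lemma second_variation_E_qnl:
  assumes "N > 0" and u: "\<And>l. u (l + 2 * N) = u l"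
  shows "second_variation (E_qnl N K \<phi> \<rho> G) (y_unif N F) u u =
    eps N * (A * (\<Sum>l = -N + 1..N. (D N u l)\<^sup>2) + (\<Sum>l = -N + 1..N. excess K g P q c (D N u) l))"
proof -
  let ?r = "D N u"
  have strain: "D N (\<lambda>l. y_unif N F l + x * u l) = (\<lambda>j. F + x * ?r j)" for x
    using assms(1) by (auto simp: D_def y_unif_def eps_def field_simps)
  obtain a where "\<And>l. has_jet2 (\<lambda>x. atom_qnl K \<phi> \<rho> G (\<lambda>j. F + x * ?r j) l) 0 (a l)
     (A / 2 * ((?r l)\<^sup>2 + (?r (l + 1))\<^sup>2) + excess K g P q c ?r l)"
    using jet_atom_qnl[of K ?r] by metis
  then have "has_jet2 (\<lambda>x. E_qnl N K \<phi> \<rho> G (\<lambda>l. y_unif N F l + x * u l)) 0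
      (eps N * (\<Sum>l = -N + 1..N. a l))
      (eps N * (\<Sum>l = -N + 1..N. A / 2 * ((?r l)\<^sup>2 + (?r (l + 1))\<^sup>2) + excess K g P q c ?r l))"
    unfolding E_qnl_def strain by (intro has_jet2_cmult has_jet2_sum)
  then have "second_variation (E_qnl N K \<phi> \<rho> G) (y_unif N F) u u =
      eps N * (\<Sum>l = -N + 1..N. A / 2 * ((?r l)\<^sup>2 + (?r (l + 1))\<^sup>2) + excess K g P q c ?r l)"
    unfolding second_variation_diagonal by (rule has_jet2_imp_deriv2)
  moreover have "(\<Sum>l = -N + 1..N. A / 2 * ((?r l)\<^sup>2 + (?r (l + 1))\<^sup>2)) = A * (\<Sum>l = -N + 1..N. (?r l)\<^sup>2)"
  proof -
    \<comment> \<open>Shifting by one bond changes the sum only by its end terms, which agree by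
      periodicity.\<close>
    have "(\<Sum>l = -N + 1..N. (?r (l + 1))\<^sup>2) = (\<Sum>l = -N + 1..N. (?r l)\<^sup>2)"
    proof -
      have "u (N + 1) = u (-N + 1)" "u N = u (-N)"
        using u[of "-N + 1"] u[of "-N"] by (simp_all add: algebra_simps)
      then have "?r (N + 1) = ?r (-N + 1)" by (simp add: D_def)
      then show ?thesis
        using sum_int_telescope[of "-N + 1" N "\<lambda>l. (?r l)\<^sup>2"] assms(1) by (simp add: sum_subtractf)
    qed
    then show ?thesis
      unfolding sum_distrib_left[symmetric] sum.distrib by simp
  qed
  ultimately show ?thesis
    by (simp only: sum.distrib)
qed

end

section \<open>Periodic displacements and their strains\<close>

lemma periodic_eq_0:
  fixes u :: "int \<Rightarrow> real"
  assumes "N > 0" and u: "\<And>l. u (l + 2 * N) = u l" and "\<And>l. l \<in> {-N + 1..N} \<Longrightarrow> u l = 0"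
  shows "u l = 0"
proof -
  interpret periodic_fun_simple u "2 * N"
    by unfold_locales (rule u)
  \<comment> \<open>The offset \<open>N - 1\<close> places the representative of \<open>l\<close> in
    \<open>-N + 1..N\<close> instead of \<open>0..2 * N - 1\<close>.\<close>
  define k where "k = (l + N - 1) div (2 * N)"
  have "l - k * (2 * N) = (l + N - 1) mod (2 * N) - N + 1"
    unfolding k_def by (simp add: minus_div_mult_eq_mod[symmetric])
  then have "u (l - k * (2 * N)) = 0"
    using assms(1) pos_mod_bound[of "2 * N" "l + N - 1"] pos_mod_sign[of "2 * N" "l + N - 1"]
    by (intro assms(3)) (simp del: pos_mod_bound pos_mod_sign)
  then show ?thesis
    using minus_of_int[of l k] by simp
qed

text \<open>Zero strain makes \<open>u\<close> constant over a period, zero mean makes that constant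
  0, and periodicity extends this to all atoms.\<close>

lemma sum_strain_squares_pos:
  assumes "N > 0" "u \<in> U_space N" "u \<noteq> (\<lambda>_. 0)"
  shows "0 < (\<Sum>l = -N + 1..N. (D N u l)\<^sup>2)"
proof (rule ccontr)
  assume "\<not> ?thesis"
  then have "(\<Sum>l = -N + 1..N. (D N u l)\<^sup>2) = 0"
    using sum_nonneg[of "{-N + 1..N}" "\<lambda>l. (D N u l)\<^sup>2"] by simp
  then have r: "D N u l = 0" if "l \<in> {-N + 1..N}" for l
    using that by (subst (asm) sum_nonneg_eq_0_iff) auto
  have const: "u l = u (-N + 1)" if "-N + 1 \<le> l" "l \<le> N" for l
    using that
  proof (induction l rule: int_ge_induct)
    case (step l)
    then show ?case
      using r[of "l + 1"] assms(1) by (simp add: D_def eps_def)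
  qed simp
  have "0 = (\<Sum>l = -N + 1..N. u l)"
    using assms(2) by (simp add: U_space_def)
  also have "\<dots> = (\<Sum>l = -N + 1..N. u (-N + 1))"
    by (intro sum.cong refl const) auto
  finally have 0: "u (-N + 1) = 0"
    using assms(1) by simp
  have "u l = 0" for l
  proof (rule periodic_eq_0[OF assms(1)])
    show "u (l + 2 * N) = u l" for l
      using assms(2) by (simp add: U_space_def)
    show "u l = 0" if "l \<in> {-N + 1..N}" for l
      using const[of l] that unfolding 0 by simp
  qed
  with assms(3) show False by auto
qed

text \<open>
  A single displaced atom at \<open>K + 3\<close> (up to periodicity and mean) strains only bonds
  at which the QNL energy coincides with the continuum energy.
\<close>
lemma continuum_test_displacement:
  assumes "0 \<le> K" "K < N - 2"
  obtains u where "u \<in> U_space N" "u \<noteq> (\<lambda>_. 0)"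
    "\<And>j. -K - 1 \<le> j \<Longrightarrow> j \<le> K + 2 \<Longrightarrow> D N u j = 0"
proof
  \<comment> \<open>Divisibility makes the unit peak periodic; subtracting
    \<open>1 / (2 * N)\<close> removes its mean over a period of \<open>2 * N\<close> atoms.\<close>
  define u :: "int \<Rightarrow> real" where
    "u l = (if 2 * N dvd l - (K + 3) then 1 else 0) - 1 / real_of_int (2 * N)" for l
  \<comment> \<open>Since \<open>K + 3 \<le> N\<close>, the distance to the peak stays below a full
    period. The window starts at \<open>-K - 2\<close> because the strain at \<open>-K - 1\<close>
    also involves that atom.\<close>
  have *: "2 * N dvd l - (K + 3) \<longleftrightarrow> l = K + 3"
    if "-N + 1 \<le> l \<and> l \<le> N \<or> -K - 2 \<le> l \<and> l \<le> K + 2" for l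
  proof -
    have "\<bar>l - (K + 3)\<bar> < 2 * N" using that assms by auto
    then show ?thesis
      using zdvd_not_zless[of "\<bar>l - (K + 3)\<bar>" "2 * N"] by (cases "l = K + 3") auto
  qed
  have "(\<Sum>l = -N + 1..N. u l) =
      (\<Sum>l = -N + 1..N. (if l = K + 3 then 1 else 0) - 1 / real_of_int (2 * N))"
    unfolding u_def using * by (intro sum.cong) auto
  also have "\<dots> = 0"
    using assms by (simp add: sum_subtractf)
  finally have sum: "(\<Sum>l = -N + 1..N. u l) = 0" .
  have "u (l + 2 * N) = u l" for l
    using dvd_add_times_triv_right_iff[of "2 * N" "l - (K + 3)" 1]
    by (simp add: u_def algebra_simps)
  with sum show "u \<in> U_space N"
    by (simp add: U_space_def)
  have "u 0 \<noteq> 0"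
    using *[of 0] assms by (simp add: u_def)
  then show "u \<noteq> (\<lambda>_. 0)" by auto
  show "D N u j = 0" if "-K - 1 \<le> j" "j \<le> K + 2" for j
    using that *[of j] *[of "j - 1"] by (simp add: D_def u_def)
qed

section \<open>The stability criterion\<close>

theorem theorem4p2:
  fixes N K :: int and F :: real and \<phi> \<rho> G :: "real \<Rightarrow> real"
  assumes "0 \<le> K" and "K < N - 2" and "F > 0"
    and "smooth_on {0<..} \<phi>" and "smooth_on {0<..} \<rho>" and "smooth_on UNIV G"
    and "deriv2 \<phi> F > 0" and "deriv2 \<phi> (2 * F) < 0"
    and "deriv \<rho> F \<le> 0" and "deriv \<rho> (2 * F) \<le> 0"
    and "deriv2 \<rho> F \<ge> 0" and "deriv2 \<rho> (2 * F) \<ge> 0"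
    and "deriv2 G (rho_bar \<rho> F) \<ge> 0"
    and "deriv2 \<phi> (2 * F)
           + deriv2 G (rho_bar \<rho> F)
             * ((deriv \<rho> F)\<^sup>2 + 20 * (deriv \<rho> (2 * F))\<^sup>2 + 12 * deriv \<rho> F * deriv \<rho> (2 * F))
           + 2 * deriv G (rho_bar \<rho> F) * deriv2 \<rho> (2 * F) \<le> 0"
  shows "stable_deformation N (E_qnl N K \<phi> \<rho> G) (y_unif N F) \<longleftrightarrow> A_hat \<rho> G F + A_tilde \<phi> F > 0"
proof -
  interpret uniform_state \<phi> \<rho> G F
    using assms(3-6) by unfold_locales (auto intro!: smooth_on_imp_has_jet2)
  have N: "N > 0" and eps: "eps N > 0"
    using assms(1,2) by (auto simp: eps_def)
  have g: "0 \<le> g" and Pq: "0 \<le> P * q"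
    using assms(9,10,13) by (auto simp: g_def P_def q_def mult_nonpos_nonpos)
  \<comment> \<open>Writing p for \<rho>'(F), \<open>P\<^sup>2 + 8 * P * q\<close> expands to
    \<open>p\<^sup>2 + 12 * p * q + 20 * q\<^sup>2\<close>, the bracket of the second-neighbour
    hypothesis.\<close>
  have c: "2 * c + g * (P\<^sup>2 + 8 * P * q) \<le> 0"
    using assms(14) by (simp add: g_def P_def q_def c_def power2_eq_square algebra_simps)
  show ?thesis
    unfolding A_def[symmetric]
  proof
    assume stable: "stable_deformation N (E_qnl N K \<phi> \<rho> G) (y_unif N F)"
    obtain u where u: "u \<in> U_space N" "u \<noteq> (\<lambda>_. 0)"
      "\<And>j. -K - 1 \<le> j \<Longrightarrow> j \<le> K + 2 \<Longrightarrow> D N u j = 0"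
      using continuum_test_displacement[OF assms(1,2)] by blast
    have "0 < second_variation (E_qnl N K \<phi> \<rho> G) (y_unif N F) u u"
      using stable u(1,2) by (auto simp: stable_deformation_def)
    also have "\<dots> = eps N * (A * (\<Sum>l = -N + 1..N. (D N u l)\<^sup>2))"
      using u(1) second_variation_E_qnl[OF N] sum_excess_eq_0[OF assms(1,2) u(3)]
      by (simp add: U_space_def)
    finally show "0 < A"
      using eps sum_strain_squares_pos[OF N u(1,2)] by (simp add: zero_less_mult_iff)
  next
    assume A: "0 < A"
    show "stable_deformation N (E_qnl N K \<phi> \<rho> G) (y_unif N F)"
      unfolding stable_deformation_def
    proof
      fix u assume "u \<in> U_space N - {\<lambda>_. 0}"
      then have u: "u \<in> U_space N" "u \<noteq> (\<lambda>_. 0)" by auto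
      have "0 < eps N * (A * (\<Sum>l = -N + 1..N. (D N u l)\<^sup>2)
          + (\<Sum>l = -N + 1..N. excess K g P q c (D N u) l))"
        using eps A sum_strain_squares_pos[OF N u] sum_excess_nonneg[OF assms(1,2) g Pq c]
        by (intro mult_pos_pos add_pos_nonneg) auto
      then show "0 < second_variation (E_qnl N K \<phi> \<rho> G) (y_unif N F) u u"
        using u(1) second_variation_E_qnl[OF N] by (simp add: U_space_def)
    qed
  qed
qed

end
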